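(* Let $G$ be a finitely generated free group (with word metric from a free generating set). A subshift $X\subset A^G$ is a subshift of finite type if and only if it is uniformly avo on the extension sets of limit tree convex sets.
   Context: $G$ is free on a finite set of generators, $d$ is the corresponding left-invariant word metric (path metric of the Cayley tree), $\mathcal B_n=\{g:d(e,g)\le n\}$ (empty for $n<0$). A limit tree convex set is a (possibly infinite) $C\subset G$ such that whenever $u,w\in C$, $v$ lies on the geodesic between $u$ and $w$, and $\min(d(v,u),d(v,w))=r$, the ball $v\mathcal B_{r-1}$ is contained in $C$. The extension sets of a family $\mathcal C$ of subsets of $G$ are the sets $C\subset G\setminus\{e\}$ such that $C\in\mathcal C$ and $C\cup\{e\}\in\mathcal C$. $A$ is a finite alphabet, $G$ acts on $A^G$ by $(gx)_h=x_{g^{-1}h}$; a subshift is a closed $G$-invariant $X\subset A^G$; it is of finite type if it is the set of all $x\in A^G$ in which no pattern (element of $A^D$, $D$ finite) from some fixed finite set occurs at any translate. $X|C=\{x|C:x\in X\}$. $X$ is uniformly avo on a family $\mathcal D$ of subsets of $G\setminus\{e\}$ if there is $r\in\mathbb N$ such that for every $C\in\mathcal D$, with $B=C\cap\mathcal B_r$, for all $x\in X|C$ and $a\in A$: $(x|B)\sqcup a^e\in X|(B\cup\{e\})\iff x\sqcup a^e\in X|(C\cup\{e\})$, where $a^e$ is the pattern with domain $\{e\}$ and value $a$. *)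

theory Defs
  imports "HOL-Algebra.Coset" "HOL-Analysis.Function_Topology"
begin

section \<open>Free groups and their word metric\<close>

text \<open>A word over \<open>S\<close> is a list of letters \<open>(s, b)\<close> with \<open>s \<in> S\<close>, where \<open>(s, True)\<close> stands
  for \<open>s\<close> and \<open>(s, False)\<close> for its formal inverse.\<close>

definition word_val :: "('g, 'm) monoid_scheme \<Rightarrow> ('g \<times> bool) list \<Rightarrow> 'g" where
  "word_val G w =
    foldr (\<lambda>(s, b) g. (if b then s else inv\<^bsub>G\<^esub> s) \<otimes>\<^bsub>G\<^esub> g) w \<one>\<^bsub>G\<^esub>"

definition reduced :: "('g \<times> bool) list \<Rightarrow> bool" where
  "reduced w \<longleftrightarrow> successively (\<lambda>(s, b) (t, c). s = t \<longrightarrow> b = c) w"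

definition free_on :: "('g, 'm) monoid_scheme \<Rightarrow> 'g set \<Rightarrow> bool" where
  "free_on G S \<longleftrightarrow> S \<subseteq> carrier G \<and>
    bij_betw (word_val G) {w \<in> lists (S \<times> UNIV). reduced w} (carrier G)"

definition word_length :: "('g, 'm) monoid_scheme \<Rightarrow> 'g set \<Rightarrow> 'g \<Rightarrow> nat" where
  "word_length G S g = (LEAST n. \<exists>w \<in> lists (S \<times> UNIV). length w = n \<and> word_val G w = g)"

definition word_dist :: "('g, 'm) monoid_scheme \<Rightarrow> 'g set \<Rightarrow> 'g \<Rightarrow> 'g \<Rightarrow> nat" where
  "word_dist G S g h = word_length G S (inv\<^bsub>G\<^esub> g \<otimes>\<^bsub>G\<^esub> h)"

text \<open>The radius is an integer so that the ball of radius \<open>-1\<close> is empty.\<close>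

definition word_ball :: "('g, 'm) monoid_scheme \<Rightarrow> 'g set \<Rightarrow> int \<Rightarrow> 'g set" where
  "word_ball G S n = {g \<in> carrier G. int (word_dist G S \<one>\<^bsub>G\<^esub> g) \<le> n}"

definition geodesic :: "('g, 'm) monoid_scheme \<Rightarrow> 'g set \<Rightarrow> 'g \<Rightarrow> 'g \<Rightarrow> 'g list \<Rightarrow> bool" where
  "geodesic G S u w p \<longleftrightarrow> p \<noteq> [] \<and> set p \<subseteq> carrier G \<and> hd p = u \<and> last p = w \<and>
    (\<forall>i < length p. \<forall>j < length p. int (word_dist G S (p ! i) (p ! j)) = \<bar>int i - int j\<bar>)"


section \<open>Limit tree convex sets and extension sets\<close>

definition limit_tree_convex :: "('g, 'm) monoid_scheme \<Rightarrow> 'g set \<Rightarrow> 'g set \<Rightarrow> bool" where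
  "limit_tree_convex G S C \<longleftrightarrow> C \<subseteq> carrier G \<and>
    (\<forall>u \<in> C. \<forall>w \<in> C. \<forall>p. geodesic G S u w p \<longrightarrow> (\<forall>v \<in> set p.
      let r = min (word_dist G S v u) (word_dist G S v w)
      in v <#\<^bsub>G\<^esub> word_ball G S (int r - 1) \<subseteq> C))"

definition extension_sets :: "('g, 'm) monoid_scheme \<Rightarrow> 'g set set \<Rightarrow> 'g set set" where
  "extension_sets G \<C> =
    {C. C \<subseteq> carrier G - {\<one>\<^bsub>G\<^esub>} \<and> C \<in> \<C> \<and> insert \<one>\<^bsub>G\<^esub> C \<in> \<C>}"


section \<open>Subshifts\<close>

text \<open>Configurations and patterns with domain \<open>D\<close> are the elements of \<open>D \<rightarrow>\<^sub>E A\<close>,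
  i.e. functions that are \<open>undefined\<close> outside \<open>D\<close>.\<close>

definition shift :: "('g, 'm) monoid_scheme \<Rightarrow> 'g \<Rightarrow> ('g \<Rightarrow> 'a) \<Rightarrow> 'g \<Rightarrow> 'a" where
  "shift G g x = (\<lambda>h \<in> carrier G. x (inv\<^bsub>G\<^esub> g \<otimes>\<^bsub>G\<^esub> h))"

definition subshift :: "('g, 'm) monoid_scheme \<Rightarrow> 'a set \<Rightarrow> ('g \<Rightarrow> 'a) set \<Rightarrow> bool" where
  "subshift G A X \<longleftrightarrow>
    closedin (product_topology (\<lambda>_. discrete_topology A) (carrier G)) X \<and>
    (\<forall>g \<in> carrier G. \<forall>x \<in> X. shift G g x \<in> X)"

text \<open>A forbidden pattern is a pair \<open>(D, p)\<close>: the domain is recorded explicitly because it cannot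
  be recovered from \<open>p\<close> when \<open>undefined \<in> A\<close>.\<close>

definition finite_type :: "('g, 'm) monoid_scheme \<Rightarrow> 'a set \<Rightarrow> ('g \<Rightarrow> 'a) set \<Rightarrow> bool" where
  "finite_type G A X \<longleftrightarrow> (\<exists>F. finite F \<and>
    (\<forall>(D, p) \<in> F. finite D \<and> D \<subseteq> carrier G \<and> p \<in> D \<rightarrow>\<^sub>E A) \<and>
    X = {x \<in> carrier G \<rightarrow>\<^sub>E A. \<forall>(D, p) \<in> F. \<forall>g \<in> carrier G. restrict (shift G g x) D \<noteq> p})"

definition restrictions :: "('g \<Rightarrow> 'a) set \<Rightarrow> 'g set \<Rightarrow> ('g \<Rightarrow> 'a) set" where
  "restrictions X C = (\<lambda>x. restrict x C) ` X"

text \<open>Since \<open>\<one> \<notin> C\<close>, the update \<open>x(\<one> := a)\<close> is the pattern with domain \<open>insert \<one> C\<close>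
  that extends \<open>x\<close> by the value \<open>a\<close> at the identity.\<close>

definition uniformly_avo ::
  "('g, 'm) monoid_scheme \<Rightarrow> 'g set \<Rightarrow> 'a set \<Rightarrow> ('g \<Rightarrow> 'a) set \<Rightarrow> 'g set set \<Rightarrow> bool" where
  "uniformly_avo G S A X \<D> \<longleftrightarrow> (\<exists>r::nat. \<forall>C \<in> \<D>. let B = C \<inter> word_ball G S (int r) in
    \<forall>x \<in> restrictions X C. \<forall>a \<in> A.
      (restrict x B)(\<one>\<^bsub>G\<^esub> := a) \<in> restrictions X (insert \<one>\<^bsub>G\<^esub> B) \<longleftrightarrow>
      x(\<one>\<^bsub>G\<^esub> := a) \<in> restrictions X (insert \<one>\<^bsub>G\<^esub> C))"

end

theory Submission
  imports Defs "HOL-Library.Sublist"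
begin

text \<open>
  Write \<open>|g|\<close> for the distance of \<open>g\<close> from \<open>\<one>\<close> in the Cayley tree and \<open>B\<^sub>n\<close> for the
  ball of radius \<open>n\<close> around \<open>\<one>\<close>.

  Finite type implies uniformly avo by gluing two configurations along thick vertices. Let \<open>K\<close>
  bound the diameters of the forbidden domains, put \<open>R = K + 1\<close>, and let \<open>x, z \<in> X\<close> agree on
  \<open>C \<inter> B\<^sub>2\<^sub>R\<close>, where \<open>C \<union> {\<one>}\<close> is limit tree convex. A vertex \<open>v\<close> with \<open>|v| = R\<close> is called
  deep if all points at distance less than \<open>R\<close> from \<open>v\<close> lie in \<open>C\<close>; on these points \<open>x\<close> and
  \<open>z\<close> agree. Let \<open>y\<close> be \<open>x\<close> behind the deep vertices (seen from \<open>\<one>\<close>) and \<open>z\<close> everywhere else. A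
  forbidden window that contains a point where \<open>y\<close> differs from \<open>z\<close> has a point behind some
  deep \<open>v\<close> at distance at least \<open>R > K\<close> from \<open>v\<close>, so the window is too small to reach past \<open>v\<close>
  and \<open>y\<close> equals \<open>x\<close> on it. Hence \<open>y \<in> X\<close>. Limit tree convexity gives that \<open>y\<close> equals \<open>x\<close> on
  \<open>C\<close>: if \<open>c \<in> C\<close> has \<open>|c| > 2R\<close>, then the vertex \<open>v\<close> at distance \<open>R\<close> from \<open>\<one>\<close> on the way to
  \<open>c\<close> is at distance at least \<open>R\<close> from both ends, so it is deep. Thus \<open>2R\<close> is an avo radius
  (\<open>finite_type_gluing\<close>).

  Conversely, let \<open>r\<close> be an avo radius and forbid all patterns on \<open>B\<^sub>r\<close> that do not occur in \<open>X\<close>.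
  Every set between \<open>B\<^sub>n\<close> and \<open>B\<^sub>n\<^sub>+\<^sub>1\<close> is limit tree convex
  (\<open>between_balls_limit_tree_convex\<close>), so the whole group is exhausted by such sets, one point at
  a time, starting from \<open>B\<^sub>-\<^sub>1 = {}\<close>. If \<open>y\<close> avoids the forbidden patterns, each added point is,
  after a translation, the point \<open>\<one>\<close> added to an extension set; the local condition holds because
  the pattern of \<open>y\<close> on the translate of \<open>B\<^sub>r\<close> occurs in \<open>X\<close>, and the avo property makes it
  global. So \<open>y\<close> restricted to any ball comes from \<open>X\<close>, and \<open>y \<in> X\<close> since \<open>X\<close> is closed.

  The geometry used is that of a \<open>0\<close>-hyperbolic space: the Gromov product at \<open>\<one>\<close> is the length
  of the longest common prefix of reduced words (\<open>dist_eq\<close>), and it satisfies the ultrametric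
  inequality (\<open>gromov_product_ultrametric\<close>). How vertices
  separate the tree then follows by linear arithmetic.
\<close>

section \<open>Reduced words\<close>

locale free_group = group G for G (structure) +
  fixes S
  assumes free: "free_on G S"
begin

\<comment> \<open>Membership in \<open>lists\<close> must not be unfolded elementwise: the facts about words are stated with it.\<close>
declare in_listsD [rule del] in_listsI [rule del]

abbreviation words where "words \<equiv> {w \<in> lists (S \<times> UNIV). reduced w}"

abbreviation len where "len \<equiv> word_length G S"

abbreviation dist where "dist \<equiv> word_dist G S"

abbreviation ball where "ball \<equiv> word_ball G S"

definition normal_form where "normal_form = the_inv_into words (word_val G)"

definition inverse_word :: "('c \<times> bool) list \<Rightarrow> ('c \<times> bool) list" where
  "inverse_word w = rev (map (\<lambda>(s, b). (s, \<not> b)) w)"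

lemma S_closed: "s \<in> S \<Longrightarrow> s \<in> carrier G"
  using free by (auto simp: free_on_def)

lemma inv_mult_cancel: "g \<in> carrier G \<Longrightarrow> h \<in> carrier G \<Longrightarrow> inv g \<otimes> (g \<otimes> h) = h"
  by (simp add: m_assoc[symmetric])

lemma word_val_Nil [simp]: "word_val G [] = \<one>"
  by (simp add: word_val_def)

lemma word_val_Cons [simp]:
  "word_val G ((s, b) # w) = (if b then s else inv s) \<otimes> word_val G w"
  by (simp add: word_val_def)

lemma word_val_closed: "w \<in> lists (S \<times> UNIV) \<Longrightarrow> word_val G w \<in> carrier G"
  by (induction w) (auto simp: S_closed)

lemma word_val_append:
  "u \<in> lists (S \<times> UNIV) \<Longrightarrow> w \<in> lists (S \<times> UNIV) \<Longrightarrow>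
    word_val G (u @ w) = word_val G u \<otimes> word_val G w"
  by (induction u) (auto simp: S_closed word_val_closed m_assoc)

lemma inverse_word_in_lists:
  "w \<in> lists (S \<times> UNIV) \<Longrightarrow> inverse_word w \<in> lists (S \<times> UNIV)"
  by (auto simp: inverse_word_def in_lists_conv_set)

lemma word_val_inverse_word:
  "w \<in> lists (S \<times> UNIV) \<Longrightarrow> word_val G (inverse_word w) = inv (word_val G w)"
proof (induction w)
  case (Cons l w)
  obtain s b where l: "l = (s, b)" by (cases l)
  with Cons.prems have s: "s \<in> carrier G" and sS: "s \<in> S" and w: "w \<in> lists (S \<times> UNIV)"
    by (auto simp: S_closed)
  have "inverse_word (l # w) = inverse_word w @ [(s, \<not> b)]"
    by (simp add: inverse_word_def l)
  moreover have "word_val G (inverse_word w @ [(s, \<not> b)]) =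
      inv (word_val G w) \<otimes> word_val G [(s, \<not> b)]"
    using w sS Cons.IH[OF w] by (subst word_val_append) (auto simp: inverse_word_in_lists)
  ultimately show ?case
    using s w by (auto simp: l inv_mult_group word_val_closed)
qed (simp add: inverse_word_def)

lemma reduced_inverse_word: "reduced (inverse_word w) \<longleftrightarrow> reduced w"
proof -
  show ?thesis
    unfolding reduced_def inverse_word_def successively_rev successively_map
    by (intro iffI; erule successively_mono) (auto split: prod.splits)
qed

lemma reduced_append_iff:
  "reduced (u @ w) \<longleftrightarrow> reduced u \<and> reduced w \<and>
    (u = [] \<or> w = [] \<or> (fst (last u) = fst (hd w) \<longrightarrow> snd (last u) = snd (hd w)))"
  unfolding reduced_def successively_append_iff by (auto simp: case_prod_beta)

lemma reduced_word_exists: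
  "w \<in> lists (S \<times> UNIV) \<Longrightarrow>
    \<exists>w' \<in> words. word_val G w' = word_val G w \<and> length w' \<le> length w"
proof (induction w)
  case Nil
  then show ?case by (auto simp: reduced_def)
next
  case (Cons l u)
  then obtain u' where u': "u' \<in> words" "word_val G u' = word_val G u" "length u' \<le> length u"
    by auto
  obtain s b where l: "l = (s, b)" by (cases l)
  with Cons.prems have s: "s \<in> S" "s \<in> carrier G"
    by (auto simp: S_closed)
  show ?case
  proof (cases "u' \<noteq> [] \<and> hd u' = (s, \<not> b)")
    case True
    then obtain t where t: "u' = (s, \<not> b) # t" by (cases u') auto
    then have "t \<in> words" using u' by (auto simp: reduced_def successively_Cons)
    moreover have "word_val G t = word_val G (l # u)"
      using s u'(2)[symmetric] word_val_closed[of t] \<open>t \<in> words\<close>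
      by (auto simp: t l m_assoc[symmetric])
    ultimately show ?thesis using u' by (intro bexI[of _ t]) (auto simp: t)
  next
    case False
    then have "reduced ([l] @ u')"
      using u' unfolding reduced_append_iff
      by (cases "hd u'") (auto simp: l reduced_def)
    then have "l # u' \<in> words" using u' s by (simp add: l)
    then show ?thesis using u' by (intro bexI[of _ "l # u'"]) (auto simp: l)
  qed
qed

lemma word_val_bij: "bij_betw (word_val G) words (carrier G)"
  using free by (simp add: free_on_def)

text \<open>Cancelling never lengthens a word, and by freeness every value has only one reduced word; so
  that word is a shortest one.\<close>

lemma word_length_word_val:
  assumes "w \<in> words"
  shows "len (word_val G w) = length w"
  unfolding word_length_def
proof (rule Least_equality)
  show "\<exists>w' \<in> lists (S \<times> UNIV). length w' = length w \<and> word_val G w' = word_val G w"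
    using assms by auto
next
  fix n assume "\<exists>w' \<in> lists (S \<times> UNIV). length w' = n \<and> word_val G w' = word_val G w"
  then obtain w' where w': "w' \<in> lists (S \<times> UNIV)" "length w' = n"
      "word_val G w' = word_val G w" by auto
  then obtain w'' where w'': "w'' \<in> words" "word_val G w'' = word_val G w" "length w'' \<le> n"
    using reduced_word_exists by metis
  then have "w'' = w"
    using word_val_bij assms by (auto simp: bij_betw_def dest: inj_onD)
  then show "length w \<le> n" using w'' by simp
qed

lemma normal_form_in_words: "g \<in> carrier G \<Longrightarrow> normal_form g \<in> words"
  unfolding normal_form_def
  using word_val_bij by (intro the_inv_into_into[where B = words]) (auto simp: bij_betw_def)

lemma word_val_normal_form: "g \<in> carrier G \<Longrightarrow> word_val G (normal_form g) = g"
  unfolding normal_form_def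
  using word_val_bij by (intro f_the_inv_into_f) (auto simp: bij_betw_def)

lemma normal_form_word_val: "w \<in> words \<Longrightarrow> normal_form (word_val G w) = w"
  unfolding normal_form_def
  using word_val_bij by (intro the_inv_into_f_f) (auto simp: bij_betw_def)

lemma length_normal_form: "g \<in> carrier G \<Longrightarrow> length (normal_form g) = len g"
  using word_length_word_val[OF normal_form_in_words] word_val_normal_form by metis

lemma word_length_mult_le:
  assumes "g \<in> carrier G" "h \<in> carrier G"
  shows "len (g \<otimes> h) \<le> len g + len h"
proof -
  let ?w = "normal_form g @ normal_form h"
  have w: "?w \<in> lists (S \<times> UNIV)"
    using assms normal_form_in_words by auto
  moreover have "word_val G ?w = g \<otimes> h"
    using assms normal_form_in_words by (subst word_val_append) (auto simp: word_val_normal_form)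
  ultimately have "len (g \<otimes> h) \<le> length ?w"
    unfolding word_length_def by (intro Least_le bexI[of _ ?w]) simp_all
  then show ?thesis using assms by (simp add: length_normal_form)
qed

section \<open>The tree metric\<close>

definition gromov_product where
  "gromov_product g h = length (longest_common_prefix (normal_form g) (normal_form h))"

lemma gromov_product_commute: "gromov_product g h = gromov_product h g"
  unfolding gromov_product_def
  by (meson longest_common_prefix_max_prefix longest_common_prefix_prefix1
      longest_common_prefix_prefix2 prefix_length_le antisym)

lemma gromov_product_le: "g \<in> carrier G \<Longrightarrow> gromov_product g h \<le> len g"
  unfolding gromov_product_def
  by (metis longest_common_prefix_prefix1 prefix_length_le length_normal_form)

text \<open>Two prefixes of \<open>v\<close> are comparable, and the shorter of the two is shared by \<open>u\<close> and \<open>w\<close>.\<close>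

lemma gromov_product_ultrametric:
  "min (gromov_product u v) (gromov_product v w) \<le> gromov_product u w"
proof -
  let ?p = "longest_common_prefix (normal_form u) (normal_form v)"
  let ?q = "longest_common_prefix (normal_form v) (normal_form w)"
  have *: "prefix ?p (normal_form u)" "prefix ?p (normal_form v)"
    "prefix ?q (normal_form v)" "prefix ?q (normal_form w)"
    by (simp_all add: longest_common_prefix_prefix1 longest_common_prefix_prefix2)
  then consider "prefix ?p ?q" | "prefix ?q ?p"
    using prefix_same_cases by blast
  then show ?thesis
  proof cases
    case 1
    then have "prefix ?p (longest_common_prefix (normal_form u) (normal_form w))"
      using * by (meson longest_common_prefix_max_prefix prefix_order.trans)
    then show ?thesis
      unfolding gromov_product_def using prefix_length_le by fastforce
  next
    case 2
    then have "prefix ?q (longest_common_prefix (normal_form u) (normal_form w))"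
      using * by (meson longest_common_prefix_max_prefix prefix_order.trans)
    then show ?thesis
      unfolding gromov_product_def using prefix_length_le by fastforce
  qed
qed

text \<open>The definition of \<open>gromov_product\<close> is by words; this identity says that it is the Gromov
  product of the word metric. After the common prefix is cancelled from \<open>inv g \<otimes> h\<close>, the two
  remaining words start with different letters, so no further cancellation takes place.\<close>

lemma dist_eq:
  assumes g: "g \<in> carrier G" and h: "h \<in> carrier G"
  shows "dist g h + 2 * gromov_product g h = len g + len h"
proof -
  let ?p = "longest_common_prefix (normal_form g) (normal_form h)"
  obtain u where u: "normal_form g = ?p @ u"
    using longest_common_prefix_prefix1 prefixE by blast
  obtain v where v: "normal_form h = ?p @ v"
    using longest_common_prefix_prefix2 prefixE by blast
  have branch: "hd u \<noteq> hd v" if "u \<noteq> []" "v \<noteq> []"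
  proof
    assume "hd u = hd v"
    then have "prefix (?p @ [hd u]) (?p @ u)" "prefix (?p @ [hd u]) (?p @ v)"
      using that by (auto simp: neq_Nil_conv)
    then have "prefix (?p @ [hd u]) (normal_form g)" "prefix (?p @ [hd u]) (normal_form h)"
      by (simp_all only: u[symmetric] v[symmetric])
    then have "prefix (?p @ [hd u]) ?p"
      by (rule longest_common_prefix_max_prefix)
    then show False by (auto dest: prefix_length_le)
  qed
  have pu: "?p @ u \<in> words" and pv: "?p @ v \<in> words"
    using normal_form_in_words[OF g] normal_form_in_words[OF h] u v by auto
  have L: "?p \<in> lists (S \<times> UNIV)" "u \<in> lists (S \<times> UNIV)" "v \<in> lists (S \<times> UNIV)"
    using pu pv by auto
  have red: "reduced u" "reduced v"
    using pu pv by (auto simp: reduced_append_iff)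
  have "reduced (inverse_word u @ v)"
    unfolding reduced_append_iff reduced_inverse_word
    using red branch
    by (cases u; cases v) (auto simp: inverse_word_def prod_eq_iff split: prod.splits)
  then have w: "inverse_word u @ v \<in> words"
    using L inverse_word_in_lists by auto
  have "inv g \<otimes> h = inv (word_val G (?p @ u)) \<otimes> word_val G (?p @ v)"
    using u v word_val_normal_form g h by metis
  also have "\<dots> = inv (word_val G u) \<otimes> word_val G v"
    using L by (simp add: word_val_append word_val_closed inv_mult_group m_assoc inv_mult_cancel)
  also have "\<dots> = word_val G (inverse_word u @ v)"
    using L by (simp add: word_val_append word_val_closed word_val_inverse_word
        inverse_word_in_lists)
  finally have "dist g h = length (inverse_word u @ v)"
    unfolding word_dist_def using word_length_word_val[OF w] by simp
  then have "dist g h = length u + length v"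
    by (simp add: inverse_word_def)
  moreover have "len g = length ?p + length u" "len h = length ?p + length v"
    using length_normal_form g h u v by (metis length_append)+
  ultimately show ?thesis by (simp add: gromov_product_def)
qed

lemma dist_commute: "g \<in> carrier G \<Longrightarrow> h \<in> carrier G \<Longrightarrow> dist g h = dist h g"
  using dist_eq[of g h] dist_eq[of h g] gromov_product_commute[of g h] by simp

lemma dist_one_left: "g \<in> carrier G \<Longrightarrow> dist \<one> g = len g"
  by (simp add: word_dist_def)

lemma dist_one_right: "g \<in> carrier G \<Longrightarrow> dist g \<one> = len g"
  using dist_commute[of g \<one>] by (simp add: dist_one_left)

lemma len_one: "len \<one> = 0"
  using word_length_word_val[of "[]"] by (simp add: reduced_def)

lemma dist_mult_left:
  "k \<in> carrier G \<Longrightarrow> g \<in> carrier G \<Longrightarrow> h \<in> carrier G \<Longrightarrow>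
    dist (k \<otimes> g) (k \<otimes> h) = dist g h"
  by (simp add: word_dist_def inv_mult_group m_assoc inv_solve_left[symmetric])
    (metis inv_closed l_inv l_one m_assoc m_closed)

lemma len_le_dist:
  assumes "g \<in> carrier G" "h \<in> carrier G"
  shows "len h \<le> len g + dist g h"
  using word_length_mult_le[of g "inv g \<otimes> h"] assms
  by (simp add: word_dist_def m_assoc[symmetric])

text \<open>In a tree the median of \<open>\<one>\<close>, \<open>u\<close>, \<open>w\<close> splits the geodesic from \<open>u\<close> to \<open>w\<close> into
  two parts, along each of which the distance to \<open>\<one>\<close> is monotone.\<close>

lemma geodesic_point_below_end:
  assumes "u \<in> carrier G" "v \<in> carrier G" "w \<in> carrier G"
    and "dist u v + dist v w = dist u w"
  shows "len v + dist v u = len u \<or> len v + dist v w = len w"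
  using dist_eq[of u v] dist_eq[of v w] dist_eq[of u w] dist_commute[of u v]
    gromov_product_ultrametric[of u v w] gromov_product_le[of v w] gromov_product_le[of v u]
    gromov_product_commute[of u v] assms
  by linarith

text \<open>A path from \<open>g\<close> of length less than \<open>dist v g\<close> cannot pass through \<open>v\<close>, hence it stays
  in the component of \<open>g\<close> in the tree without \<open>v\<close>.\<close>

lemma behind_vertex_stable:
  assumes "v \<in> carrier G" "g \<in> carrier G" "h \<in> carrier G"
    and "len v + dist v g = len g" "dist g h < dist v g"
  shows "len v + dist v h = len h"
  using dist_eq[of v g] dist_eq[of g h] dist_eq[of v h]
    gromov_product_ultrametric[of v g h] gromov_product_le[of v h] gromov_product_le[of h g]
    gromov_product_commute[of g h] assms
  by linarith

text \<open>The prefixes of the reduced word of \<open>g\<close> trace the geodesic from \<open>\<one>\<close> to \<open>g\<close>.\<close>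

lemma geodesic_from_one_through:
  assumes g: "g \<in> carrier G" and i: "i \<le> len g"
  obtains p v where "geodesic G S \<one> g p" "v \<in> set p" "v \<in> carrier G" "len v = i"
    "len v + dist v g = len g"
proof -
  define q where "q j = word_val G (take j (normal_form g))" for j
  have t: "take j (normal_form g) \<in> words" for j
    using normal_form_in_words[OF g] reduced_append_iff append_take_drop_id
    by (metis (mono_tags, lifting) append_in_lists_conv mem_Collect_eq)
  have qc: "q j \<in> carrier G" for j
    using t word_val_closed by (auto simp: q_def)
  have lq: "len (q j) = j" if "j \<le> len g" for j
    using that word_length_word_val[OF t] by (simp add: q_def length_normal_form g)
  have dle: "dist (q j) (q k) = k - j" if "j \<le> k" "k \<le> len g" for j k
  proof -
    have "prefix (take j (normal_form g)) (take k (normal_form g))"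
      using that by (metis min.absorb1 take_is_prefix take_take)
    then have "prefix (normal_form (q j)) (normal_form (q k))"
      by (simp add: q_def normal_form_word_val[OF t])
    then have "j \<le> gromov_product (q j) (q k)"
      unfolding gromov_product_def using that lq[of j] length_normal_form[OF qc[of j]]
      by (metis longest_common_prefix_max_prefix prefix_length_le prefix_order.refl le_trans)
    then have "gromov_product (q j) (q k) = j"
      using gromov_product_le[OF qc, of j "q k"] lq[of j] that by simp
    then show ?thesis
      using dist_eq[OF qc qc, of j k] lq that by simp
  qed
  have d: "int (dist (q j) (q k)) = \<bar>int j - int k\<bar>" if "j \<le> len g" "k \<le> len g" for j k
    using dle[of j k] dle[of k j] dist_commute[OF qc qc, of j k] that
    by (cases "j \<le> k") auto
  have q0: "q 0 = \<one>" and ql: "q (len g) = g"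
    using g by (simp_all add: q_def word_val_normal_form flip: length_normal_form)
  let ?p = "map q [0..<Suc (len g)]"
  have "geodesic G S \<one> g ?p"
    unfolding geodesic_def using d qc q0 ql
    by (auto simp: hd_map last_map nth_append simp del: upt_Suc)
  moreover have "q i \<in> set ?p" using i by (auto simp del: upt_Suc)
  moreover have "len (q i) + dist (q i) g = len g"
    using dle[of i "len g"] lq[OF i] i ql by simp
  ultimately show thesis using that qc lq[OF i] by blast
qed

section \<open>Limit tree convex sets\<close>

lemma word_ball_iff: "g \<in> ball n \<longleftrightarrow> g \<in> carrier G \<and> int (len g) \<le> n"
  by (auto simp: word_ball_def dist_one_left)

lemma l_coset_ball_iff:
  assumes "v \<in> carrier G"
  shows "h \<in> v <# ball n \<longleftrightarrow> h \<in> carrier G \<and> int (dist v h) \<le> n"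
proof
  assume "h \<in> v <# ball n"
  then obtain b where "b \<in> ball n" "h = v \<otimes> b" by (auto simp: l_coset_def)
  then show "h \<in> carrier G \<and> int (dist v h) \<le> n"
    using assms by (auto simp: word_ball_iff word_dist_def m_assoc[symmetric])
next
  assume h: "h \<in> carrier G \<and> int (dist v h) \<le> n"
  then have "inv v \<otimes> h \<in> ball n" "h = v \<otimes> (inv v \<otimes> h)"
    using assms by (auto simp: word_ball_iff word_dist_def m_assoc[symmetric])
  then show "h \<in> v <# ball n" by (auto simp: l_coset_def)
qed

lemma geodesic_subset: "geodesic G S u w p \<Longrightarrow> set p \<subseteq> carrier G"
  by (simp add: geodesic_def)

lemma limit_tree_convex_iff:
  "limit_tree_convex G S C \<longleftrightarrow> C \<subseteq> carrier G \<and>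
    (\<forall>u \<in> C. \<forall>w \<in> C. \<forall>p. geodesic G S u w p \<longrightarrow> (\<forall>v \<in> set p. \<forall>h \<in> carrier G.
      dist v h < min (dist v u) (dist v w) \<longrightarrow> h \<in> C))"
proof -
  have "v <# ball (int r - 1) \<subseteq> C \<longleftrightarrow> (\<forall>h \<in> carrier G. dist v h < r \<longrightarrow> h \<in> C)"
    if "v \<in> carrier G" for v r
    using l_coset_ball_iff[OF that] by auto
  then show ?thesis
    unfolding limit_tree_convex_def Let_def using geodesic_subset
    by (smt (verit, ccfv_threshold) subsetD)
qed

lemma geodesic_between:
  assumes "geodesic G S u w p" "v \<in> set p"
  shows "dist u v + dist v w = dist u w"
proof -
  let ?n = "length p - 1"
  have p: "p \<noteq> []" "p ! 0 = u" "p ! ?n = w"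
    and d: "\<And>i j. i < length p \<Longrightarrow> j < length p \<Longrightarrow> int (dist (p ! i) (p ! j)) = \<bar>int i - int j\<bar>"
    using assms(1) by (auto simp: geodesic_def hd_conv_nth last_conv_nth)
  obtain i where i: "i < length p" "p ! i = v"
    using assms(2) by (auto simp: in_set_conv_nth)
  show ?thesis
    using d[of 0 i] d[of i ?n] d[of 0 ?n] i p by auto
qed

lemma geodesic_translate:
  assumes "geodesic G S u w p" "k \<in> carrier G"
  shows "geodesic G S (k \<otimes> u) (k \<otimes> w) (map (\<lambda>g. k \<otimes> g) p)"
proof -
  have "p ! i \<in> carrier G" if "i < length p" for i
    using assms(1) that by (auto simp: geodesic_def)
  then show ?thesis
    using assms by (auto simp: geodesic_def hd_map last_map dist_mult_left)
qed

lemma limit_tree_convex_translate: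
  assumes C: "limit_tree_convex G S C" and k: "k \<in> carrier G"
  shows "limit_tree_convex G S ((\<lambda>g. k \<otimes> g) ` C)"
  unfolding limit_tree_convex_iff
proof (intro conjI ballI allI impI)
  have sub: "C \<subseteq> carrier G" using C by (simp add: limit_tree_convex_def)
  then show "(\<lambda>g. k \<otimes> g) ` C \<subseteq> carrier G" using k by auto
  fix u w p v h
  assume "u \<in> (\<lambda>g. k \<otimes> g) ` C" "w \<in> (\<lambda>g. k \<otimes> g) ` C" and p: "geodesic G S u w p"
    and v: "v \<in> set p" and h: "h \<in> carrier G" and d: "dist v h < min (dist v u) (dist v w)"
  then obtain u' w' where u': "u' \<in> C" "u = k \<otimes> u'" and w': "w' \<in> C" "w = k \<otimes> w'" by auto
  have cancel: "inv k \<otimes> (k \<otimes> c) = c" if "c \<in> carrier G" for c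
    using that k by (simp add: m_assoc[symmetric])
  have vc: "v \<in> carrier G" using v geodesic_subset[OF p] by auto
  have carr: "u' \<in> carrier G" "w' \<in> carrier G" using u' w' sub by auto
  have "geodesic G S u' w' (map (\<lambda>g. inv k \<otimes> g) p)"
    using geodesic_translate[OF p, of "inv k"] k u' w' carr cancel by simp
  moreover have "inv k \<otimes> v \<in> set (map (\<lambda>g. inv k \<otimes> g) p)" using v by simp
  moreover have "dist (inv k \<otimes> v) (inv k \<otimes> h) <
      min (dist (inv k \<otimes> v) u') (dist (inv k \<otimes> v) w')"
    using d dist_mult_left[of "inv k"] k vc h carr cancel u' w'
    by (metis inv_closed m_closed)
  ultimately have "inv k \<otimes> h \<in> C"
    using C u' w' h k unfolding limit_tree_convex_iff by blast
  moreover have "h = k \<otimes> (inv k \<otimes> h)"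
    using h k by (simp add: m_assoc[symmetric])
  ultimately show "h \<in> (\<lambda>g. k \<otimes> g) ` C" by auto
qed

text \<open>Moving from a point \<open>v\<close> of a geodesic towards the end that lies behind \<open>v\<close>, the distance to
  \<open>\<one>\<close> grows as fast as in any direction. As that end has length at most \<open>n + 1\<close>, the points that are
  strictly closer to \<open>v\<close> than it is have length at most \<open>n\<close>.\<close>

lemma between_balls_limit_tree_convex:
  assumes "ball n \<subseteq> C" "C \<subseteq> ball (n + 1)"
  shows "limit_tree_convex G S C"
  unfolding limit_tree_convex_iff
proof (intro conjI ballI allI impI)
  show "C \<subseteq> carrier G" using assms by (auto simp: word_ball_iff)
  fix u w p v h
  assume u: "u \<in> C" and w: "w \<in> C" and p: "geodesic G S u w p" and v: "v \<in> set p"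
    and h: "h \<in> carrier G" and d: "dist v h < min (dist v u) (dist v w)"
  have carr: "u \<in> carrier G" "w \<in> carrier G" "v \<in> carrier G"
    using u w v \<open>C \<subseteq> carrier G\<close> geodesic_subset[OF p] by auto
  have lens: "int (len u) \<le> n + 1" "int (len w) \<le> n + 1"
    using u w assms(2) by (auto simp: word_ball_iff)
  have "len v + dist v u = len u \<or> len v + dist v w = len w"
    using geodesic_point_below_end carr geodesic_between[OF p v] by blast
  then have "int (len h) \<le> n"
    using len_le_dist[of v h] carr h d lens by linarith
  then show "h \<in> C" using assms(1) h by (auto simp: word_ball_iff)
qed

lemma finite_ball:
  assumes "finite S"
  shows "finite (ball n)"
proof (rule finite_subset)
  let ?W = "{w. set w \<subseteq> S \<times> (UNIV :: bool set) \<and> length w \<le> nat n}"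
  show "ball n \<subseteq> word_val G ` ?W"
  proof
    fix g assume "g \<in> ball n"
    then have g: "g \<in> carrier G" "len g \<le> nat n" by (auto simp: word_ball_iff)
    then have "normal_form g \<in> ?W"
      using normal_form_in_words[OF g(1)] by (auto simp: length_normal_form in_lists_conv_set)
    then show "g \<in> word_val G ` ?W"
      using word_val_normal_form[OF g(1)] by (intro image_eqI[of g _ "normal_form g"]) simp
  qed
  show "finite (word_val G ` ?W)"
    using assms by (intro finite_imageI finite_lists_length_le) auto
qed

section \<open>Finite type implies uniformly avo\<close>

text \<open>The gluing construction: \<open>x\<close> provides the values far from \<open>\<one>\<close>, where \<open>C\<close> is known to be
  thick, and \<open>z\<close> provides those near \<open>\<one>\<close>, in particular at \<open>\<one>\<close> itself. Both are needed also off
  \<open>C\<close>, where nothing is prescribed but no forbidden pattern may arise.\<close>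

lemma finite_type_gluing:
  assumes X: "X = {x \<in> carrier G \<rightarrow>\<^sub>E A. \<forall>(D, p) \<in> F. \<forall>g \<in> carrier G. restrict (shift G g x) D \<noteq> p}"
    and F: "\<And>D p. (D, p) \<in> F \<Longrightarrow> D \<subseteq> carrier G"
    and K: "\<And>D p a b. (D, p) \<in> F \<Longrightarrow> a \<in> D \<Longrightarrow> b \<in> D \<Longrightarrow> dist a b \<le> K"
    and C: "limit_tree_convex G S (insert \<one> C)"
    and x: "x \<in> X" and z: "z \<in> X"
    and agree: "\<And>c. c \<in> C \<Longrightarrow> len c \<le> 2 * (K + 1) \<Longrightarrow> z c = x c"
  shows "\<exists>y \<in> X. y \<one> = z \<one> \<and> (\<forall>c \<in> C - {\<one>}. y c = x c)"
proof -
  let ?R = "K + 1"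
  define deep where "deep v \<longleftrightarrow> v \<in> carrier G \<and> len v = ?R \<and>
      (\<forall>h \<in> carrier G. dist v h < ?R \<longrightarrow> h \<in> C)" for v
  define behind where "behind g \<longleftrightarrow> (\<exists>v. deep v \<and> len v + dist v g = len g)" for g
  define y where "y g = (if behind g then x g else z g)" for g
  have Cc: "C \<subseteq> carrier G" using C by (auto simp: limit_tree_convex_def)
  have "\<not> behind \<one>"
    by (auto simp: behind_def deep_def len_one)
  then have "y \<one> = z \<one>" by (simp add: y_def)
  moreover have "y c = x c" if c: "c \<in> C - {\<one>}" for c
  proof (cases "len c \<le> 2 * ?R")
    case True
    then show ?thesis using agree c by (auto simp: y_def)
  next
    case False
    have cc: "c \<in> carrier G" using c Cc by auto
    obtain p v where p: "geodesic G S \<one> c p" "v \<in> set p" "v \<in> carrier G" "len v = ?R"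
        "len v + dist v c = len c"
      using geodesic_from_one_through[OF cc, of ?R] False by auto
    \<comment> \<open>\<open>v\<close> is at distance at least \<open>R\<close> from both \<open>\<one>\<close> and \<open>c\<close>, so convexity fills the ball around it.\<close>
    have "h \<in> C" if h: "h \<in> carrier G" "dist v h < ?R" for h
    proof -
      have "dist v h < min (dist v \<one>) (dist v c)"
        using h p False by (simp add: dist_one_right)
      then have "h \<in> insert \<one> C"
        using C c p(1,2) h(1) unfolding limit_tree_convex_iff by blast
      moreover have "h \<noteq> \<one>" using h p by (auto simp: dist_one_right)
      ultimately show ?thesis by simp
    qed
    then have "deep v" using p by (auto simp: deep_def)
    then have "behind c" using p by (auto simp: behind_def)
    then show ?thesis by (simp add: y_def)
  qed
  moreover have "y \<in> X"
    unfolding X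
  proof (intro CollectI conjI ballI, goal_cases)
    case 1
    have "x \<in> carrier G \<rightarrow>\<^sub>E A" "z \<in> carrier G \<rightarrow>\<^sub>E A" using x z by (auto simp: X)
    then show ?case by (auto simp: y_def PiE_iff extensional_def)
  next
    case (2 Dp)
    obtain D p where Dp: "Dp = (D, p)" by (cases Dp)
    have "restrict (shift G g y) D \<noteq> p" if g: "g \<in> carrier G" for g
    proof -
      have Dc: "D \<subseteq> carrier G" using F 2 Dp by auto
      have window: "inv g \<otimes> a \<in> carrier G" if "a \<in> D" for a
        using that Dc g by auto
      have diam: "dist (inv g \<otimes> a) (inv g \<otimes> b) \<le> K" if "a \<in> D" "b \<in> D" for a b
        using that Dc g K[of D p a b] 2 Dp by (simp add: dist_mult_left subsetD)
      have cases: "(\<forall>a \<in> D. y (inv g \<otimes> a) = z (inv g \<otimes> a)) \<or>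
          (\<forall>a \<in> D. y (inv g \<otimes> a) = x (inv g \<otimes> a))"
      proof (rule disjCI)
        assume "\<not> (\<forall>a \<in> D. y (inv g \<otimes> a) = x (inv g \<otimes> a))"
        then obtain b where b: "b \<in> D" "y (inv g \<otimes> b) \<noteq> x (inv g \<otimes> b)" by auto
        show "\<forall>a \<in> D. y (inv g \<otimes> a) = z (inv g \<otimes> a)"
        proof (rule ballI, rule ccontr)
          fix a assume a: "a \<in> D" and ne: "y (inv g \<otimes> a) \<noteq> z (inv g \<otimes> a)"
          let ?a = "inv g \<otimes> a"
          have "behind ?a" and xz: "x ?a \<noteq> z ?a"
            using ne by (auto simp: y_def split: if_splits)
          then obtain v where v: "deep v" "len v + dist v ?a = len ?a"
            by (auto simp: behind_def)
          have vc: "v \<in> carrier G" "len v = ?R" using v by (auto simp: deep_def)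
          \<comment> \<open>Close to \<open>v\<close> the two configurations agree, so the difference occurs far behind \<open>v\<close>.\<close>
          have "\<not> dist v ?a < ?R"
          proof
            assume less: "dist v ?a < ?R"
            then have "?a \<in> C" using v(1) window[OF a] by (auto simp: deep_def)
            moreover have "len ?a \<le> 2 * ?R" using v(2) vc less by simp
            ultimately show False using agree[of ?a] xz by simp
          qed
          then have "dist ?a (inv g \<otimes> b) < dist v ?a"
            using diam[OF a b(1)] by linarith
          then have "len v + dist v (inv g \<otimes> b) = len (inv g \<otimes> b)"
            using behind_vertex_stable[OF vc(1) window[OF a] window[OF b(1)] v(2)] by simp
          then have "behind (inv g \<otimes> b)" using v(1) by (auto simp: behind_def)
          then show False using b(2) by (simp add: y_def)
        qed
      qed
      have same: "restrict (shift G g y) D = restrict (shift G g w) D"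
        if "\<forall>a \<in> D. y (inv g \<otimes> a) = w (inv g \<otimes> a)" for w
        using that Dc by (intro restrict_ext) (simp add: shift_def subsetD)
      have avoid: "restrict (shift G g w) D \<noteq> p" if "w \<in> X" for w
      proof -
        from that have "\<forall>(D, p) \<in> F. \<forall>g \<in> carrier G. restrict (shift G g w) D \<noteq> p"
          unfolding X mem_Collect_eq by (rule conjunct2)
        from bspec[OF this 2] show ?thesis using g by (simp add: Dp)
      qed
      from cases show ?thesis
        using same[of x] same[of z] avoid[OF x] avoid[OF z] by (elim disjE) simp_all
    qed
    then show ?case by (simp add: Dp)
  qed
  ultimately show ?thesis by blast
qed

lemma finite_type_imp_uniformly_avo:
  assumes "finite_type G A X"
  shows "uniformly_avo G S A X (extension_sets G {C. limit_tree_convex G S C})"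
proof -
  obtain F where finF: "finite F"
    and F': "\<forall>(D, p) \<in> F. finite D \<and> D \<subseteq> carrier G \<and> p \<in> D \<rightarrow>\<^sub>E A"
    and X: "X = {x \<in> carrier G \<rightarrow>\<^sub>E A. \<forall>(D, p) \<in> F. \<forall>g \<in> carrier G. restrict (shift G g x) D \<noteq> p}"
    using assms unfolding finite_type_def by (elim exE conjE)
  have F: "finite D \<and> D \<subseteq> carrier G" if "(D, p) \<in> F" for D p
    using bspec[OF F' that] by simp
  define distances where "distances = (\<Union>(D, p) \<in> F. (\<lambda>(a, b). dist a b) ` (D \<times> D))"
  have "finite distances" using finF F by (auto simp: distances_def)
  then obtain K where "\<And>d. d \<in> distances \<Longrightarrow> d \<le> K"
    using finite_nat_set_iff_bounded_le by auto
  then have K: "dist a b \<le> K" if "(D, p) \<in> F" "a \<in> D" "b \<in> D" for D p a b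
    using that by (force simp: distances_def)
  \<comment> \<open>\<open>B\<^sub>r\<close> must contain the balls of radius \<open>K\<close> around the vertices of length \<open>K + 1\<close>, and every
    point of \<open>C\<close> that is not far enough to make the vertex before it deep.\<close>
  let ?r = "2 * (K + 1)"
  show ?thesis
    unfolding uniformly_avo_def Let_def
  proof (intro exI[of _ ?r] ballI)
    fix C x a
    let ?B = "C \<inter> ball (int ?r)"
    assume C: "C \<in> extension_sets G {C. limit_tree_convex G S C}"
      and x: "x \<in> restrictions X C" and a: "a \<in> A"
    have one: "\<one> \<notin> C" and Cc: "C \<subseteq> carrier G" and ltc: "limit_tree_convex G S (insert \<one> C)"
      using C by (auto simp: extension_sets_def)
    obtain x' where x': "x' \<in> X" "x = restrict x' C"
      using x by (auto simp: restrictions_def)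
    show "(restrict x ?B)(\<one> := a) \<in> restrictions X (insert \<one> ?B) \<longleftrightarrow>
        x(\<one> := a) \<in> restrictions X (insert \<one> C)" (is "?small \<longleftrightarrow> ?large")
    proof
      assume ?small
      then obtain z where z: "z \<in> X" "(restrict x ?B)(\<one> := a) = restrict z (insert \<one> ?B)"
        by (auto simp: restrictions_def)
      have "z \<one> = a" using fun_cong[OF z(2), of \<one>] by simp
      have "z c = x' c" if "c \<in> C" "len c \<le> ?r" for c
        using fun_cong[OF z(2), of c] that one Cc x'(2)
        by (auto simp: word_ball_iff split: if_splits)
      then have "\<exists>y \<in> X. y \<one> = z \<one> \<and> (\<forall>c \<in> C - {\<one>}. y c = x' c)"
        using F by (intro finite_type_gluing[OF X _ K ltc x'(1) z(1)]) blast+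
      then obtain y where y: "y \<in> X" "y \<one> = a" "\<forall>c \<in> C. y c = x' c"
        using one \<open>z \<one> = a\<close> by auto
      then have "x(\<one> := a) = restrict y (insert \<one> C)"
        using one x'(2) by (auto simp: fun_eq_iff)
      then show ?large using y(1) by (auto simp: restrictions_def)
    next
      assume ?large
      then obtain y where y: "y \<in> X" "x(\<one> := a) = restrict y (insert \<one> C)"
        by (auto simp: restrictions_def)
      have "(restrict x ?B)(\<one> := a) = restrict y (insert \<one> ?B)"
      proof
        fix g show "((restrict x ?B)(\<one> := a)) g = restrict y (insert \<one> ?B) g"
          using fun_cong[OF y(2), of g] one by (auto split: if_splits)
      qed
      then show ?small using y(1) by (auto simp: restrictions_def)
    qed
  qed
qed

section \<open>Uniformly avo implies finite type\<close>

text \<open>A neighbourhood of \<open>y\<close> in the product topology constrains only finitely many coordinates, and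
  these lie in one ball.\<close>

lemma closed_mem_if_balls:
  assumes X: "closedin (product_topology (\<lambda>_. discrete_topology A) (carrier G)) X"
    and y: "y \<in> carrier G \<rightarrow>\<^sub>E A"
    and balls: "\<And>n::nat. restrict y (ball (int n)) \<in> restrictions X (ball (int n))"
  shows "y \<in> X"
proof (rule ccontr)
  assume "y \<notin> X"
  let ?T = "product_topology (\<lambda>_. discrete_topology A) (carrier G)"
  have "openin ?T (topspace ?T - X)" using X by (simp only: closedin_def)
  moreover have "y \<in> topspace ?T - X" using y \<open>y \<notin> X\<close> by simp
  ultimately obtain U where U: "finite {g \<in> carrier G. U g \<noteq> A}" "y \<in> Pi\<^sub>E (carrier G) U"
      "Pi\<^sub>E (carrier G) U \<subseteq> topspace ?T - X"
    unfolding openin_product_topology_alt by (metis (no_types, lifting) Collect_cong topspace_discrete_topology)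
  obtain n where n: "\<And>g. g \<in> carrier G \<Longrightarrow> U g \<noteq> A \<Longrightarrow> len g \<le> n"
    using finite_imageI[OF U(1), of len] by (auto simp: finite_nat_set_iff_bounded_le)
  obtain x where x: "x \<in> X" "restrict y (ball (int n)) = restrict x (ball (int n))"
    using balls[of n] by (auto simp: restrictions_def)
  have "x \<in> carrier G \<rightarrow>\<^sub>E A" using closedin_subset[OF X] x(1) by auto
  moreover have "x g \<in> U g" if g: "g \<in> carrier G" for g
  proof (cases "U g = A")
    case True
    then show ?thesis using g \<open>x \<in> carrier G \<rightarrow>\<^sub>E A\<close> by auto
  next
    case False
    then have "x g = y g"
      using n[OF g] g fun_cong[OF x(2), of g] by (auto simp: word_ball_iff split: if_splits)
    then show ?thesis using U(2) g by (auto simp: PiE_iff)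
  qed
  ultimately have "x \<in> Pi\<^sub>E (carrier G) U" by (auto simp: PiE_iff)
  then show False using U(3) x(1) by auto
qed

lemma uniformly_avo_imp_finite_type:
  assumes "finite S" "finite A" "subshift G A X"
    and "uniformly_avo G S A X (extension_sets G {C. limit_tree_convex G S C})"
  shows "finite_type G A X"
proof -
  have closed: "closedin (product_topology (\<lambda>_. discrete_topology A) (carrier G)) X"
    and inv: "\<And>g x. g \<in> carrier G \<Longrightarrow> x \<in> X \<Longrightarrow> shift G g x \<in> X"
    using assms(3) by (auto simp: subshift_def)
  have XA: "X \<subseteq> carrier G \<rightarrow>\<^sub>E A" using closedin_subset[OF closed] by simp
  obtain r :: nat where r: "\<And>C x a. C \<in> extension_sets G {C. limit_tree_convex G S C} \<Longrightarrow>
      x \<in> restrictions X C \<Longrightarrow> a \<in> A \<Longrightarrow>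
      (restrict x (C \<inter> ball (int r)))(\<one> := a) \<in> restrictions X (insert \<one> (C \<inter> ball (int r))) \<Longrightarrow>
      x(\<one> := a) \<in> restrictions X (insert \<one> C)"
    using assms(4) unfolding uniformly_avo_def Let_def by blast
  let ?D = "ball (int r)"
  let ?P = "(?D \<rightarrow>\<^sub>E A) - restrictions X ?D"
  let ?F = "Pair ?D ` ?P"
  have Dc: "?D \<subseteq> carrier G" by (auto simp: word_ball_iff)
  have finD: "finite ?D" by (rule finite_ball[OF assms(1)])
  have "finite (?D \<rightarrow>\<^sub>E A)" using finD assms(2) by (intro finite_PiE) auto
  then have finF: "finite ?F" by blast
  let ?Y = "{x \<in> carrier G \<rightarrow>\<^sub>E A. \<forall>(D, p) \<in> ?F. \<forall>g \<in> carrier G. restrict (shift G g x) D \<noteq> p}"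
  have "X \<subseteq> ?Y"
    using XA inv by (auto simp: restrictions_def)
  moreover have "?Y \<subseteq> X"
  proof
    fix y assume y: "y \<in> ?Y"
    then have yA: "y \<in> carrier G \<rightarrow>\<^sub>E A" by simp
    have shiftA: "shift G g y \<in> carrier G \<rightarrow>\<^sub>E A" if "g \<in> carrier G" for g
      using that yA by (auto simp: shift_def)
    have allowed: "restrict (shift G g y) ?D \<in> restrictions X ?D" if g: "g \<in> carrier G" for g
    proof (rule ccontr)
      assume "restrict (shift G g y) ?D \<notin> restrictions X ?D"
      moreover have "restrict (shift G g y) ?D \<in> ?D \<rightarrow>\<^sub>E A"
        using shiftA[OF g] Dc by (auto simp: PiE_iff)
      moreover have "\<forall>p \<in> ?P. \<forall>g \<in> carrier G. restrict (shift G g y) ?D \<noteq> p"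
        using y by simp
      ultimately show False using g by blast
    qed
    \<comment> \<open>Adding \<open>g\<close> to \<open>C\<close> is, translated by \<open>inv g\<close>, adding \<open>\<one>\<close> to an extension set.\<close>
    have step: "restrict y (insert g C) \<in> restrictions X (insert g C)"
      if C: "restrict y C \<in> restrictions X C" and g: "g \<in> carrier G" "g \<notin> C"
        and ltc: "limit_tree_convex G S C" "limit_tree_convex G S (insert g C)" for g C
    proof -
      let ?C = "(\<lambda>c. inv g \<otimes> c) ` C"
      let ?y = "shift G (inv g) y"
      have Cc: "C \<subseteq> carrier G" using ltc by (simp add: limit_tree_convex_def)
      have ins: "insert \<one> ?C = (\<lambda>c. inv g \<otimes> c) ` insert g C" using g by simp
      have one: "\<one> \<notin> ?C"
      proof
        assume "\<one> \<in> ?C"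
        then obtain c where "c \<in> C" "inv g \<otimes> c = \<one>" by auto
        then show False using g Cc by (metis inv_closed inv_equality inv_inv subsetD)
      qed
      have ext: "?C \<in> extension_sets G {C. limit_tree_convex G S C}"
      proof -
        have "limit_tree_convex G S ?C" "limit_tree_convex G S (insert \<one> ?C)"
          unfolding ins using g ltc by (simp_all only: limit_tree_convex_translate inv_closed)
        moreover have "?C \<subseteq> carrier G" using Cc g by auto
        ultimately show ?thesis using one by (simp add: extension_sets_def subset_Diff_insert)
      qed
      obtain x where x: "x \<in> X" "restrict y C = restrict x C"
        using C by (auto simp: restrictions_def)
      have xy: "x c = y c" if "c \<in> C" for c
        using fun_cong[OF x(2), of c] that by simp
      have "restrict ?y ?C = restrict (shift G (inv g) x) ?C"
        using g Cc xy by (intro restrict_ext) (auto simp: shift_def m_assoc[symmetric] subsetD)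
      then have 1: "restrict ?y ?C \<in> restrictions X ?C"
        using inv[of "inv g" x] g x(1) by (auto simp: restrictions_def)
      have 2: "y g \<in> A" using yA g by auto
      have y1: "?y \<one> = y g" using g by (simp add: shift_def)
      let ?B = "?C \<inter> ?D"
      obtain z where z: "z \<in> X" "restrict ?y ?D = restrict z ?D"
        using allowed[of "inv g"] g by (auto simp: restrictions_def)
      have zy: "z h = ?y h" if "h \<in> ?D" for h
        using fun_cong[OF z(2), of h] that by simp
      have oneD: "\<one> \<in> ?D" by (simp add: word_ball_iff len_one)
      have "(restrict (restrict ?y ?C) ?B)(\<one> := y g) = restrict z (insert \<one> ?B)"
        using zy y1 oneD by (auto simp: fun_eq_iff)
      then have 3: "(restrict (restrict ?y ?C) ?B)(\<one> := y g) \<in> restrictions X (insert \<one> ?B)"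
        using z(1) by (auto simp: restrictions_def)
      obtain w where w: "w \<in> X" "(restrict ?y ?C)(\<one> := y g) = restrict w (insert \<one> ?C)"
        using r[OF ext 1 2 3] by (auto simp: restrictions_def)
      have wy: "w h = ?y h" if "h \<in> insert \<one> ?C" for h
        using fun_cong[OF w(2), of h] that y1 by (auto split: if_splits)
      have "shift G g w c = y c" if "c \<in> insert g C" for c
      proof -
        have c: "c \<in> carrier G" using that Cc g by auto
        have "w (inv g \<otimes> c) = ?y (inv g \<otimes> c)"
          using that ins by (intro wy) auto
        also have "\<dots> = y c"
          using c g by (simp add: shift_def m_assoc[symmetric])
        finally show ?thesis using c by (simp add: shift_def)
      qed
      then have "restrict y (insert g C) = restrict (shift G g w) (insert g C)"
        by (auto simp: fun_eq_iff)
      then show ?thesis using inv[OF g(1) w(1)] by (auto simp: restrictions_def)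
    qed
    have grow: "restrict y (ball (n + 1)) \<in> restrictions X (ball (n + 1))"
      if n: "restrict y (ball n) \<in> restrictions X (ball n)" for n
    proof -
      have "restrict y (ball n \<union> E) \<in> restrictions X (ball n \<union> E)"
        if "finite E" "E \<subseteq> ball (n + 1) - ball n" for E
        using that
      proof (induction E rule: finite_induct)
        case empty
        then show ?case using n by (simp only: Un_empty_right)
      next
        case (insert g E)
        have sub: "ball n \<subseteq> ball (n + 1)" by (auto simp: word_ball_iff)
        have "limit_tree_convex G S (ball n \<union> E)"
          "limit_tree_convex G S (insert g (ball n \<union> E))"
          using insert.prems sub by (intro between_balls_limit_tree_convex[of n]; auto)+
        moreover have "g \<in> carrier G" "g \<notin> ball n \<union> E"
          using insert.prems insert.hyps by (auto simp: word_ball_iff)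
        moreover have "restrict y (ball n \<union> E) \<in> restrictions X (ball n \<union> E)"
          using insert.IH insert.prems by blast
        ultimately show ?case
          unfolding Un_insert_right by (intro step)
      qed
      moreover have "ball n \<union> (ball (n + 1) - ball n) = ball (n + 1)"
        by (auto simp: word_ball_iff)
      moreover have "finite (ball (n + 1) - ball n)"
        using finite_ball[OF assms(1)] by blast
      ultimately show ?thesis by (metis subset_refl)
    qed
    have "restrict y (ball (int n - 1)) \<in> restrictions X (ball (int n - 1))" for n
    proof (induction n)
      case 0
      \<comment> \<open>The exhaustion starts from the empty set, where the claim only says that \<open>X\<close> is nonempty;
        this holds since \<open>y\<close> shows an allowed pattern, which occurs in \<open>X\<close>.\<close>
      have "ball (int 0 - 1) = {}" by (auto simp: word_ball_iff)
      moreover obtain x where "x \<in> X" using allowed[of \<one>] by (auto simp: restrictions_def)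
      moreover have "restrict y {} = restrict x {}" by (auto simp: restrict_def)
      ultimately show ?case unfolding restrictions_def by (metis image_eqI)
    next
      case (Suc n)
      have "int n - 1 + 1 = int (Suc n) - 1" by simp
      then show ?case using grow[OF Suc.IH] by (simp only:)
    qed
    then have "restrict y (ball (int (Suc n) - 1)) \<in> restrictions X (ball (int (Suc n) - 1))" for n .
    then have "restrict y (ball (int n)) \<in> restrictions X (ball (int n))" for n
      by (simp only: of_nat_Suc add_diff_cancel_left')
    then show "y \<in> X" by (rule closed_mem_if_balls[OF closed yA])
  qed
  ultimately have "X = ?Y" by (rule equalityI)
  moreover have "\<forall>(D, p) \<in> ?F. finite D \<and> D \<subseteq> carrier G \<and> p \<in> D \<rightarrow>\<^sub>E A"
    using finD Dc by auto
  ultimately show ?thesis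
    unfolding finite_type_def using finF by (intro exI[of _ ?F] conjI)
qed

end

theorem theorem7p7:
  fixes G :: "('g, 'm) monoid_scheme" and S :: "'g set"
    and A :: "'a set" and X :: "('g \<Rightarrow> 'a) set"
  assumes "group G" and "finite S" and "free_on G S"
    and "finite A" and "subshift G A X"
  shows "finite_type G A X \<longleftrightarrow>
    uniformly_avo G S A X (extension_sets G {C. limit_tree_convex G S C})"
proof -
  interpret free_group G S
    using assms by (simp add: free_group_def free_group_axioms_def)
  show ?thesis
    using finite_type_imp_uniformly_avo uniformly_avo_imp_finite_type assms by blast
qed

end
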